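(* For every integer $d\geq 360756$ we have $C(d,2)>0.684\,d^2$.
   Context: $C(d,2)$ denotes the largest number of vertices of a Cayley graph of diameter two and degree $d$. Here, for a finite group $\Gamma$ and a generating set $X\subset\Gamma$ with $1_\Gamma\notin X$ and $X=X^{-1}$, the Cayley graph $\mathrm{Cay}(\Gamma,X)$ has vertex set $\Gamma$ and edges $\{g,h\}$ whenever $g^{-1}h\in X$; its degree is $|X|$. *)

theory Defs
  imports "HOL-Algebra.Generated_Groups" Complex_Main
begin

definition cayley_adj :: "('a, 'b) monoid_scheme \<Rightarrow> 'a set \<Rightarrow> 'a \<Rightarrow> 'a \<Rightarrow> bool" where
  "cayley_adj G X g h \<longleftrightarrow> inv\<^bsub>G\<^esub> g \<otimes>\<^bsub>G\<^esub> h \<in> X"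

definition cayley_set :: "('a, 'b) monoid_scheme \<Rightarrow> 'a set \<Rightarrow> bool" where
  "cayley_set G X \<longleftrightarrow> group G \<and> finite (carrier G) \<and> X \<subseteq> carrier G \<and>
     \<one>\<^bsub>G\<^esub> \<notin> X \<and> (\<lambda>x. inv\<^bsub>G\<^esub> x) ` X = X \<and> generate G X = carrier G"

definition cayley_diam2 :: "('a, 'b) monoid_scheme \<Rightarrow> 'a set \<Rightarrow> bool" where
  "cayley_diam2 G X \<longleftrightarrow>
     (\<forall>g\<in>carrier G. \<forall>h\<in>carrier G. g = h \<or> cayley_adj G X g h \<or>
        (\<exists>k\<in>carrier G. cayley_adj G X g k \<and> cayley_adj G X k h)) \<and>
     (\<exists>g\<in>carrier G. \<exists>h\<in>carrier G. g \<noteq> h \<and> \<not> cayley_adj G X g h)"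

text \<open>C(d,2): the largest order of a Cayley graph of degree d and diameter two.
  Every finite group is isomorphic to one with carrier a set of naturals, so it suffices
  to range over groups on type nat.\<close>
definition C2 :: "nat \<Rightarrow> nat" where
  "C2 d = Sup {card (carrier G) | (G :: nat monoid) X.
              cayley_set G X \<and> card X = d \<and> cayley_diam2 G X}"

end

theory Submission
  imports Defs "HOL-Number_Theory.Cong" "HOL-Library.Code_Binary_Nat"
begin

text \<open>
  For odd \<open>n\<close> let \<open>t\<close> act on \<open>(\<int>/n)\<^sup>2 \<times> (\<int>/n)\<^sup>2\<close> by \<open>(v, v') \<mapsto> (-v', -v)\<close>, and let \<open>D\<close> be the \<open>n\<^sup>2\<close> elements
  \<open>((a, a\<^sup>2), (b, b\<^sup>2), t)\<close>. Then \<open>D = D\<inverse>\<close>, and \<open>D D\<close> contains all translations whose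
  first coordinates are units. Multiplying \<open>D\<close> by vertical translations from the left and from the right
  exchanges their two coordinates, so that about \<open>n\<^sup>2 / 2\<close> of them suffice to cover the coset of \<open>t\<close>. If
  almost all residues modulo \<open>n\<close> are units, \<open>O(n)\<close> or a small multiple of \<open>n\<^sup>2\<close> further translations
  cover the rest. This gives a Cayley graph of order \<open>2 n\<^sup>4\<close> and degree close to \<open>1.5 n\<^sup>2\<close>, i.e. of order
  close to \<open>8/9 d\<^sup>2\<close>, and for other degrees one enlarges the connection set. The loss incurred is
  controlled by choosing \<open>n = r 101\<^sup>a\<close> with \<open>r\<close> from a finite list of primes.
\<close>

section \<open>Cayley graphs and C2\<close>

text \<open>Every vertex is the identity, an element of \<open>X\<close> or a product of two such
  elements. This bounds the set under \<open>Sup\<close> in \<open>C2\<close>, so that each of its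
  members is at most \<open>C2\<close>.\<close>

lemma card_le_Moore_bound:
  fixes G (structure)
  assumes "cayley_set G X" "cayley_diam2 G X"
  shows "card (carrier G) \<le> (card X)^2 + card X + 1"
proof -
  interpret group G using assms(1) by (simp add: cayley_set_def)
  have X: "X \<subseteq> carrier G" "finite (carrier G)" using assms(1) by (auto simp: cayley_set_def)
  then have fX: "finite X" using finite_subset by blast
  have "carrier G \<subseteq> insert \<one> (X \<union> (\<lambda>(x,y). x \<otimes> y) ` (X \<times> X))"
  proof
    fix h assume h: "h \<in> carrier G"
    have "\<one> = h \<or> cayley_adj G X \<one> h \<or> (\<exists>k\<in>carrier G. cayley_adj G X \<one> k \<and> cayley_adj G X k h)"
      using assms(2) h unfolding cayley_diam2_def by blast
    moreover have "h \<in> (\<lambda>(x,y). x \<otimes> y) ` (X \<times> X)"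
      if "k \<in> carrier G" "cayley_adj G X \<one> k" "cayley_adj G X k h" for k
    proof -
      have "h = k \<otimes> (inv k \<otimes> h)" using that h by (simp add: m_assoc[symmetric])
      then show ?thesis using that h unfolding cayley_adj_def by (intro image_eqI[of _ _ "(k, inv k \<otimes> h)"]) auto
    qed
    ultimately show "h \<in> insert \<one> (X \<union> (\<lambda>(x,y). x \<otimes> y) ` (X \<times> X))"
      using h unfolding cayley_adj_def by auto
  qed
  then have "card (carrier G) \<le> card (insert \<one> (X \<union> (\<lambda>(x,y). x \<otimes> y) ` (X \<times> X)))"
    using fX by (intro card_mono) auto
  also have "\<dots> \<le> 1 + card (X \<union> (\<lambda>(x,y). x \<otimes> y) ` (X \<times> X))"
    by (simp add: card_insert_le_m1 card_insert_if fX)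
  also have "\<dots> \<le> 1 + (card X + card ((\<lambda>(x,y). x \<otimes> y) ` (X \<times> X)))"
    using card_Un_le by auto
  also have "card ((\<lambda>(x,y). x \<otimes> y) ` (X \<times> X)) \<le> card X * card X"
    using card_image_le[of "X \<times> X"] fX by (simp add: card_cartesian_product)
  finally show ?thesis by (simp add: power2_eq_square)
qed

lemma card_le_C2:
  fixes G :: "nat monoid"
  assumes "cayley_set G X" "cayley_diam2 G X"
  shows "card (carrier G) \<le> C2 (card X)"
  unfolding C2_def
proof (rule cSup_upper)
  show "bdd_above {card (carrier G) |(G :: nat monoid) Xa.
      cayley_set G Xa \<and> card Xa = card X \<and> cayley_diam2 G Xa}"
    using card_le_Moore_bound by (intro bdd_aboveI[of _ "(card X)^2 + card X + 1"]) fastforce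
qed (use assms in auto)

text \<open>\<open>C2\<close> ranges over groups on \<open>nat\<close>, so the structure is
  transported along an injection \<open>f\<close>. The covering property gives both generation and
  distances at most two; the strict cardinality inequality excludes a smaller diameter.\<close>

lemma (in group) card_le_C2_if_products_cover:
  assumes fin: "finite (carrier G)" and X: "X \<subseteq> carrier G" "\<one> \<notin> X"
    and inv: "\<And>x. x \<in> X \<Longrightarrow> inv x \<in> X"
    and cover: "\<And>g. g \<in> carrier G \<Longrightarrow> g = \<one> \<or> g \<in> X \<or> (\<exists>x\<in>X. \<exists>y\<in>X. g = x \<otimes> y)"
    and card: "card X + 1 < card (carrier G)"
  shows "card (carrier G) \<le> C2 (card X)"
proof -
  obtain f :: "'a \<Rightarrow> nat" where f: "inj_on f (carrier G)"
    using finite_imp_inj_to_nat_seg[OF fin] by blast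
  define g where "g = inv_into (carrier G) f"
  define H where "H = \<lparr>carrier = f ` carrier G, monoid.mult = (\<lambda>x y. f (g x \<otimes> g y)), one = f \<one>\<rparr>"
  have gf [simp]: "g (f x) = x" if "x \<in> carrier G" for x using f that by (simp add: g_def)
  have H [simp]: "carrier H = f ` carrier G" "\<one>\<^bsub>H\<^esub> = f \<one>" by (auto simp: H_def)
  have Hm [simp]: "f x \<otimes>\<^bsub>H\<^esub> f y = f (x \<otimes> y)" if "x \<in> carrier G" "y \<in> carrier G" for x y
    using that by (simp add: H_def)
  have gH: "group H"
  proof (rule groupI)
    show "\<exists>y\<in>carrier H. y \<otimes>\<^bsub>H\<^esub> x = \<one>\<^bsub>H\<^esub>" if "x \<in> carrier H" for x
      using that by (auto intro!: bexI[of _ "inv _"])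
  qed (auto simp: m_assoc)
  interpret H: group H by (rule gH)
  have Hi [simp]: "inv\<^bsub>H\<^esub> (f x) = f (inv x)" if "x \<in> carrier G" for x
    using that by (intro H.inv_equality) auto
  have XG: "x \<in> carrier G" if "x \<in> X" for x using that X by auto
  have memX: "f x \<in> f ` X \<longleftrightarrow> x \<in> X" if "x \<in> carrier G" for x
    using that XG inj_onD[OF f] by blast
  have adj: "cayley_adj H (f ` X) (f x) (f y) \<longleftrightarrow> inv x \<otimes> y \<in> X"
    if "x \<in> carrier G" "y \<in> carrier G" for x y
    using that by (simp add: cayley_adj_def memX)
  have invim: "(\<lambda>x. inv\<^bsub>H\<^esub> x) ` f ` X = f ` X"
  proof -
    have "(\<lambda>x. inv\<^bsub>H\<^esub> x) ` f ` X = f ` (\<lambda>x. inv x) ` X"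
      unfolding image_image by (intro image_cong) (auto simp: XG)
    also have "(\<lambda>x. inv x) ` X = X"
    proof
      show "X \<subseteq> (\<lambda>x. inv x) ` X"
      proof
        fix x assume "x \<in> X"
        then show "x \<in> (\<lambda>x. inv x) ` X" using inv XG by (intro image_eqI[of _ _ "inv x"]) auto
      qed
    qed (use inv in auto)
    finally show ?thesis .
  qed
  have gen: "generate H (f ` X) = carrier H"
  proof
    show "generate H (f ` X) \<subseteq> carrier H" using X by (intro H.generate_incl) auto
    show "carrier H \<subseteq> generate H (f ` X)"
    proof
      fix h assume "h \<in> carrier H"
      then obtain k where k: "k \<in> carrier G" "h = f k" by auto
      have i: "f x \<in> generate H (f ` X)" if "x \<in> X" for x using that by (intro generate.incl) auto
      from cover[OF k(1)] show "h \<in> generate H (f ` X)"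
      proof (elim disjE bexE)
        assume "k = \<one>" then show ?thesis using k generate.one[of H] by auto
      next
        assume "k \<in> X" then show ?thesis using k i by auto
      next
        fix x y assume "x \<in> X" "y \<in> X" "k = x \<otimes> y"
        then show ?thesis using k generate.eng[OF i i, of x y] XG by simp
      qed
    qed
  qed
  have cs: "cayley_set H (f ` X)"
    unfolding cayley_set_def using gH fin X invim gen memX[of "\<one>"] by auto
  have cd: "cayley_diam2 H (f ` X)"
    unfolding cayley_diam2_def
  proof (intro conjI ballI)
    fix h k assume "h \<in> carrier H" "k \<in> carrier H"
    then obtain x y where xy: "x \<in> carrier G" "y \<in> carrier G" "h = f x" "k = f y" by auto
    have "inv x \<otimes> y \<in> carrier G" using xy by auto
    from cover[OF this] show "h = k \<or> cayley_adj H (f ` X) h k \<or>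
        (\<exists>l\<in>carrier H. cayley_adj H (f ` X) h l \<and> cayley_adj H (f ` X) l k)"
    proof (elim disjE bexE)
      assume "inv x \<otimes> y = \<one>" then have "x = y" using xy
        by (metis inv_equality inv_inv inv_closed)
      then show ?thesis using xy by auto
    next
      assume "inv x \<otimes> y \<in> X" then show ?thesis using xy adj by auto
    next
      fix a b assume ab: "a \<in> X" "b \<in> X" "inv x \<otimes> y = a \<otimes> b"
      \<comment> \<open>The factorisation of \<open>inv x \<otimes> y\<close> as
        \<open>a \<otimes> b\<close> gives the path from \<open>x\<close> through
        \<open>x \<otimes> a\<close> to \<open>y\<close>.\<close>
      have c: "x \<otimes> a \<in> carrier G" using xy ab XG by auto
      have 1: "inv x \<otimes> (x \<otimes> a) = a" using xy XG[OF ab(1)] by (simp add: m_assoc[symmetric])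
      have "inv (x \<otimes> a) \<otimes> y = inv a \<otimes> (inv x \<otimes> y)"
        using xy XG[OF ab(1)] by (simp add: inv_mult_group m_assoc)
      also have "\<dots> = b" using ab XG by (simp add: m_assoc[symmetric])
      finally have 2: "inv (x \<otimes> a) \<otimes> y = b" .
      show ?thesis using xy adj c 1 2 ab by (intro disjI2 bexI[of _ "f (x \<otimes> a)"]) auto
    qed
  next
    have fX: "finite X" using X(1) fin finite_subset by blast
    then have "card (insert \<one> X) < card (carrier G)" using card X by simp
    then have "\<not> carrier G \<subseteq> insert \<one> X"
      using card_mono[of "insert \<one> X" "carrier G"] fX by (meson finite_insert leD)
    then obtain y where y: "y \<in> carrier G" "y \<noteq> \<one>" "y \<notin> X" by auto
    then have "f \<one> \<noteq> f y" using inj_onD[OF f] one_closed by metis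
    then show "\<exists>h\<in>carrier H. \<exists>k\<in>carrier H. h \<noteq> k \<and> \<not> cayley_adj H (f ` X) h k"
      using y adj[of "\<one>" y] by (intro bexI[of _ "f \<one>"] bexI[of _ "f y"]) auto
  qed
  have "card (f ` X) = card X" "card (f ` carrier G) = card (carrier G)"
    using f X(1) by (auto intro!: card_image inj_on_subset[OF f])
  then show ?thesis using card_le_C2[OF cs cd] by simp
qed

section \<open>Raising the degree\<close>

text \<open>Orbits of \<open>f\<close> have one or two elements, and the fixed point
  \<open>w\<close> lets both parities of \<open>k\<close> occur. The induction discards two-element
  orbits until all points are fixed or \<open>k\<close> is within one of
  \<open>card W\<close>.\<close>

lemma involution_invariant_subset:
  assumes "finite W" "\<And>x. x \<in> W \<Longrightarrow> f x \<in> W" "\<And>x. x \<in> W \<Longrightarrow> f (f x) = x"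
    and "w \<in> W" "f w = w" "k \<le> card W"
  shows "\<exists>Y\<subseteq>W. card Y = k \<and> f ` Y \<subseteq> Y"
  using assms
proof (induction "card W" arbitrary: W k rule: less_induct)
  case less
  show ?case
  proof (cases "\<forall>x\<in>W. f x = x")
    case True
    obtain Y where "Y \<subseteq> W" "card Y = k"
      using obtain_subset_with_card_n[OF less.prems(6)] by metis
    then show ?thesis using True by (intro exI[of _ Y]) auto
  next
    case False
    then obtain x where x: "x \<in> W" "f x \<noteq> x" by auto
    let ?W = "W - {x, f x}"
    have c: "card ?W = card W - 2" "card W \<ge> 2"
      using x less.prems(1,2) card_mono[of W "{x, f x}"] by (auto simp: card_Diff_subset)
    consider "k \<le> card W - 2" | "k = card W - 1" | "k = card W" using less.prems(6) by linarith
    then show ?thesis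
    proof cases
      case 1
      have "\<exists>Y\<subseteq>?W. card Y = k \<and> f ` Y \<subseteq> Y"
      proof (rule less.hyps)
        show "card ?W < card W" using c by linarith
        show "f y \<in> ?W" if "y \<in> ?W" for y
          using that less.prems(2,3) x by (metis DiffD1 DiffD2 DiffI insert_iff singletonD)
        show "w \<in> ?W" using less.prems(3-5) x by (metis DiffI insert_iff singletonD)
      qed (use less.prems c 1 in auto)
      then show ?thesis by blast
    next
      case 2
      have "f ` (W - {w}) \<subseteq> W - {w}" using less.prems(2-5) by auto
      then show ?thesis using 2 less.prems by (intro exI[of _ "W - {w}"]) auto
    next
      case 3
      then show ?thesis using less.prems by (intro exI[of _ W]) auto
    qed
  qed
qed

text \<open>Enlarging \<open>X\<close> by an inverse-closed set preserves the covering property. The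
  involution \<open>t\<close> outside \<open>X\<close> is the fixed point of inversion that makes
  every degree from \<open>card X\<close> on reachable.\<close>

lemma (in group) card_le_C2_if_degree_ge:
  assumes fin: "finite (carrier G)" and X: "X \<subseteq> carrier G" "\<one> \<notin> X"
    and inv: "\<And>x. x \<in> X \<Longrightarrow> inv x \<in> X"
    and cover: "\<And>g. g \<in> carrier G \<Longrightarrow> g = \<one> \<or> g \<in> X \<or> (\<exists>x\<in>X. \<exists>y\<in>X. g = x \<otimes> y)"
    and t: "t \<in> carrier G" "t \<notin> X" "t \<noteq> \<one>" "inv t = t"
    and d: "card X \<le> d" "d + 1 < card (carrier G)"
  shows "card (carrier G) \<le> C2 d"
proof -
  have fX: "finite X" using X(1) fin finite_subset by blast
  let ?W = "carrier G - insert \<one> X"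
  have "card ?W = card (carrier G) - (card X + 1)"
    using fX X by (subst card_Diff_subset) auto
  then have k: "d - card X \<le> card ?W" using d by linarith
  have "inv x \<in> ?W" if "x \<in> ?W" for x
    using that inv[of "inv x"] inv_eq_1_iff[of x] by auto
  then obtain Y where Y: "Y \<subseteq> ?W" "card Y = d - card X" "(\<lambda>x. inv x) ` Y \<subseteq> Y"
    using involution_invariant_subset[of ?W "\<lambda>x. inv x" t, OF _ _ _ _ _ k] fin t by auto
  have fY: "finite Y" using Y(1) fin finite_subset by blast
  have cXY: "card (X \<union> Y) = d"
    using fX fY Y(1,2) d by (subst card_Un_disjoint) auto
  have "card (carrier G) \<le> C2 (card (X \<union> Y))"
  proof (rule card_le_C2_if_products_cover)
    show "g = \<one> \<or> g \<in> X \<union> Y \<or> (\<exists>x\<in>X \<union> Y. \<exists>y\<in>X \<union> Y. g = x \<otimes> y)" if "g \<in> carrier G" for g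
      using cover[OF that] by blast
  qed (use fin X inv Y cXY d in auto)
  then show ?thesis by (simp add: cXY)
qed

section \<open>The group and its connection set\<close>

text \<open>
  The semidirect product of \<open>(\<int>/n)\<^sup>2 \<times> (\<int>/n)\<^sup>2\<close> with the group of order 2 whose generator \<open>t\<close> maps
  \<open>(v, v')\<close> to \<open>(-v', -v)\<close>; the last component is \<open>True\<close> on the nontrivial coset.
\<close>
definition swap_group :: "int \<Rightarrow> (int \<times> int \<times> int \<times> int \<times> bool) monoid" where
  "swap_group n = \<lparr>carrier = {0..<n} \<times> {0..<n} \<times> {0..<n} \<times> {0..<n} \<times> UNIV,
     monoid.mult = (\<lambda>(x, y, z, w, s) (x', y', z', w', s').
       if s then ((x - z') mod n, (y - w') mod n, (z - x') mod n, (w - y') mod n, \<not> s')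
       else ((x + x') mod n, (y + y') mod n, (z + z') mod n, (w + w') mod n, s')),
     one = (0, 0, 0, 0, False)\<rparr>"

lemma swap_group_simps [simp]:
  "carrier (swap_group n) = {0..<n} \<times> {0..<n} \<times> {0..<n} \<times> {0..<n} \<times> UNIV"
  "\<one>\<^bsub>swap_group n\<^esub> = (0, 0, 0, 0, False)"
  "(x, y, z, w, s) \<otimes>\<^bsub>swap_group n\<^esub> (x', y', z', w', s') =
    (if s then ((x - z') mod n, (y - w') mod n, (z - x') mod n, (w - y') mod n, \<not> s')
     else ((x + x') mod n, (y + y') mod n, (z + z') mod n, (w + w') mod n, s'))"
  by (simp_all add: swap_group_def)

lemma group_swap_group:
  assumes "0 < n"
  shows "group (swap_group n)"
proof (rule groupI)
  fix g h k
  assume "g \<in> carrier (swap_group n)" "h \<in> carrier (swap_group n)" "k \<in> carrier (swap_group n)"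
  then show "g \<otimes>\<^bsub>swap_group n\<^esub> h \<otimes>\<^bsub>swap_group n\<^esub> k =
    g \<otimes>\<^bsub>swap_group n\<^esub> (h \<otimes>\<^bsub>swap_group n\<^esub> k)"
    by (cases g; cases h; cases k) (simp add: mod_simps algebra_simps)
next
  fix g assume g: "g \<in> carrier (swap_group n)"
  obtain x y z w s where xs: "g = (x, y, z, w, s)" by (cases g)
  show "\<exists>h\<in>carrier (swap_group n). h \<otimes>\<^bsub>swap_group n\<^esub> g = \<one>\<^bsub>swap_group n\<^esub>"
  proof (cases s)
    case True
    then show ?thesis using g xs by (intro bexI[of _ "(z, w, x, y, True)"]) auto
  next
    case False
    then show ?thesis using assms xs
      by (intro bexI[of _ "((- x) mod n, (- y) mod n, (- z) mod n, (- w) mod n, False)"])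
        (auto simp: mod_simps)
  qed
qed (use assms in \<open>auto split: if_splits\<close>)

lemma inv_swap_group:
  assumes "0 < n" "(x, y, z, w, s) \<in> carrier (swap_group n)"
  shows "inv\<^bsub>swap_group n\<^esub> (x, y, z, w, s) =
    (if s then (z, w, x, y, True)
     else ((- x) mod n, (- y) mod n, (- z) mod n, (- w) mod n, False))"
  using assms by (intro group.inv_equality[OF group_swap_group]) (auto simp: mod_simps)

lemma card_carrier_swap_group: "card (carrier (swap_group n)) = 2 * nat n ^ 4"
  by (simp add: card_cartesian_product numeral_eq_Suc algebra_simps)

text \<open>For \<open>y\<close> in \<open>{0..<n}\<close> this is the distance from
  \<open>y\<close> to 0 on the cycle of length \<open>n\<close>. It is invariant under negation, so
  comparing norms gives an inverse-closed condition.\<close>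

definition cyc_norm :: "int \<Rightarrow> int \<Rightarrow> int" where
  "cyc_norm n y = min y (n - y)"

text \<open>
  Since \<open>(v, t)(v', t) = (v - swap v', 1)\<close>, products of two elements of this part realise the differences
  \<open>(a - b, a\<^sup>2 - b\<^sup>2)\<close> in both coordinate pairs independently; these determine \<open>a\<close> and \<open>b\<close> as soon as
  \<open>a - b\<close> is a unit.
\<close>
definition parabola_part :: "int \<Rightarrow> (int \<times> int \<times> int \<times> int \<times> bool) set" where
  "parabola_part n =
    (\<lambda>(a, b). (a, a * a mod n, b, b * b mod n, True)) ` ({0..<n} \<times> {0..<n})"

text \<open>
  Multiplying the parabola part by a vertical translation \<open>(y, w)\<close> from the left shifts it by \<open>(y, w)\<close>,
  from the right by \<open>(-w, -y)\<close>. Hence half of all translations suffice.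
\<close>
definition axis_part :: "int \<Rightarrow> (int \<times> int \<times> int \<times> int \<times> bool) set" where
  "axis_part n = (\<lambda>(y, w). (0, y, 0, w, False)) `
    ({(y, w) \<in> {0..<n} \<times> {0..<n}. cyc_norm n w \<le> cyc_norm n y} - {(0, 0)})"

text \<open>
  Takes care of the translations whose first or third coordinate is not a unit; \<open>e\<close> will satisfy
  \<open>2 e = (n - 1) / 2\<close> modulo \<open>n\<close>.
\<close>
definition correction_part :: "int \<Rightarrow> int \<Rightarrow> (int \<times> int \<times> int \<times> int \<times> bool) set" where
  "correction_part n e = (\<lambda>((u, z), c). (u, c, z, c, False)) `
    ({(u, z) \<in> {0..<n} \<times> {0..<n}. \<not> coprime u n \<or> \<not> coprime z n} \<times> {e, n - e})"

definition connection_set :: "int \<Rightarrow> int \<Rightarrow> (int \<times> int \<times> int \<times> int \<times> bool) set" where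
  "connection_set n e = parabola_part n \<union> axis_part n \<union> correction_part n e"

lemma parabola_partI:
  assumes "a \<in> {0..<n}" "b \<in> {0..<n}"
  shows "(a, a * a mod n, b, b * b mod n, True) \<in> connection_set n e"
  using assms by (force simp: connection_set_def parabola_part_def)

lemma axis_partI:
  assumes "y \<in> {0..<n}" "w \<in> {0..<n}" "cyc_norm n w \<le> cyc_norm n y" "(y, w) \<noteq> (0, 0)"
  shows "(0, y, 0, w, False) \<in> connection_set n e"
  using assms unfolding connection_set_def axis_part_def by (intro UnI1 UnI2 image_eqI[of _ _ "(y, w)"]) auto

lemma correction_partI:
  assumes "u \<in> {0..<n}" "z \<in> {0..<n}" "\<not> coprime u n \<or> \<not> coprime z n" "c = e \<or> c = n - e"
  shows "(u, c, z, c, False) \<in> connection_set n e"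
  using assms unfolding connection_set_def correction_part_def
  by (intro UnI2 image_eqI[of _ _ "((u, z), c)"]) auto

section \<open>Closure under inversion\<close>

lemma neg_mod_eq: "(- y) mod n = (if y = 0 then 0 else n - y)" if "y \<in> {0..<n}" for y n :: int
  using that by (auto simp: zmod_zminus1_eq_if)

lemma coprime_neg_mod: "coprime ((- u) mod n) n \<longleftrightarrow> coprime u n" for u n :: int
  by (simp add: coprime_iff_gcd_eq_1 gcd.commute[of _ n] flip: gcd_red_int)

lemma cyc_norm_neg_mod: "cyc_norm n ((- y) mod n) = cyc_norm n y" if "y \<in> {0..<n}"
  using that by (auto simp: neg_mod_eq cyc_norm_def)

lemma axis_partI_neg:
  assumes "y \<in> {0..<n}" "w \<in> {0..<n}" "cyc_norm n w \<le> cyc_norm n y" "(y, w) \<noteq> (0, 0)"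
  shows "(0, (- y) mod n, 0, (- w) mod n, False) \<in> connection_set n e"
proof (rule axis_partI)
  show "((- y) mod n, (- w) mod n) \<noteq> (0, 0)"
    using assms by (simp add: neg_mod_eq)
qed (use assms in \<open>auto simp: cyc_norm_neg_mod\<close>)

lemma connection_set_cases [consumes 1, case_names parabola axis correction]:
  assumes "g \<in> connection_set n e"
  obtains a b where "a \<in> {0..<n}" "b \<in> {0..<n}" "g = (a, a * a mod n, b, b * b mod n, True)"
  | y w where "y \<in> {0..<n}" "w \<in> {0..<n}" "cyc_norm n w \<le> cyc_norm n y" "(y, w) \<noteq> (0, 0)"
      "g = (0, y, 0, w, False)"
  | u z c where "u \<in> {0..<n}" "z \<in> {0..<n}" "\<not> coprime u n \<or> \<not> coprime z n" "c = e \<or> c = n - e"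
      "g = (u, c, z, c, False)"
proof -
  consider "g \<in> parabola_part n" | "g \<in> axis_part n" | "g \<in> correction_part n e"
    using assms unfolding connection_set_def by blast
  then show thesis
  proof cases
    case 1
    then obtain a b where "a \<in> {0..<n}" "b \<in> {0..<n}" "g = (a, a * a mod n, b, b * b mod n, True)"
      unfolding parabola_part_def by auto
    then show thesis by (rule that(1))
  next
    case 2
    then obtain y w where "y \<in> {0..<n}" "w \<in> {0..<n}" "cyc_norm n w \<le> cyc_norm n y"
        "(y, w) \<noteq> (0, 0)" "g = (0, y, 0, w, False)"
      unfolding axis_part_def by auto
    then show thesis by (rule that(2))
  next
    case 3
    then obtain u z c where "u \<in> {0..<n}" "z \<in> {0..<n}" "\<not> coprime u n \<or> \<not> coprime z n"
        "c = e \<or> c = n - e" "g = (u, c, z, c, False)"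
      unfolding correction_part_def by auto
    then show thesis by (rule that(3))
  qed
qed

lemma connection_set_inv:
  assumes e: "0 < e" "e < n" and g: "g \<in> connection_set n e"
  shows "inv\<^bsub>swap_group n\<^esub> g \<in> connection_set n e"
  using g
proof (cases rule: connection_set_cases)
  case (parabola a b)
  then have "inv\<^bsub>swap_group n\<^esub> g = (b, b * b mod n, a, a * a mod n, True)"
    using e inv_swap_group[of n a "a * a mod n" b "b * b mod n" True] by auto
  then show ?thesis using parabola parabola_partI[of b n a] by simp
next
  case (axis y w)
  then have "inv\<^bsub>swap_group n\<^esub> g = (0, (- y) mod n, 0, (- w) mod n, False)"
    using e inv_swap_group[of n 0 y 0 w False] by auto
  moreover have "(0, (- y) mod n, 0, (- w) mod n, False) \<in> connection_set n e"
    using axis by (intro axis_partI_neg)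
  ultimately show ?thesis by simp
next
  case (correction u z c)
  then have "inv\<^bsub>swap_group n\<^esub> g = ((- u) mod n, n - c, (- z) mod n, n - c, False)"
    using e inv_swap_group[of n u c z c False] by (auto simp: neg_mod_eq[of c n])
  moreover have "\<not> coprime ((- u) mod n) n \<or> \<not> coprime ((- z) mod n) n"
    using correction by (simp add: coprime_neg_mod)
  ultimately show ?thesis
    using correction e correction_partI[of "(- u) mod n" n "(- z) mod n" "n - c" e] by auto
qed

section \<open>Covering the group by products\<close>

text \<open>Shifting \<open>y\<close> by \<open>-h\<close> turns its norm \<open>m\<close> into
  \<open>h - m\<close> if \<open>y \<le> h\<close> and into \<open>h + 1 - m\<close> otherwise. This
  reverses the order up to an error of one, which a strict inequality of integers absorbs.\<close>

lemma cyc_norm_shift: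
  fixes y w h n :: int
  assumes n: "n = 2 * h + 1" and yw: "y \<in> {0..<n}" "w \<in> {0..<n}"
  shows "cyc_norm n w \<le> cyc_norm n y \<or> cyc_norm n ((w - h) mod n) \<le> cyc_norm n ((y - h) mod n)"
proof -
  have "(v - h) mod n = (if h \<le> v then v - h else v - h + n)" if "v \<in> {0..<n}" for v
  proof (cases "h \<le> v")
    case False
    then have "(v - h + n) mod n = v - h + n" using that n by (intro mod_pos_pos_trivial) auto
    then show ?thesis using False by simp
  qed (use that n in \<open>auto intro!: mod_pos_pos_trivial\<close>)
  then have "(y - h) mod n = (if h \<le> y then y - h else y - h + n)"
    "(w - h) mod n = (if h \<le> w then w - h else w - h + n)" using yw by auto
  then show ?thesis unfolding cyc_norm_def using n yw
    by (cases "h \<le> y"; cases "h \<le> w"; simp only: if_True if_False atLeastLessThan_iff; linarith)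
qed

text \<open>
  Shifting by \<open>\<plusminus>e\<close> rather than by \<open>0\<close> and \<open>h\<close> keeps the correction part closed under inversion.
\<close>
lemma axis_shift_cover:
  fixes y w h n e :: int
  assumes n: "n = 2 * h + 1" "0 < n" and e: "(2 * e) mod n = h mod n"
  shows "cyc_norm n ((w + e) mod n) \<le> cyc_norm n ((y + e) mod n) \<or>
         cyc_norm n ((w - e) mod n) \<le> cyc_norm n ((y - e) mod n)"
proof -
  have "((v + e) mod n - h) mod n = (v - e) mod n" for v
  proof -
    have "((v + e) mod n - h) mod n = (v + e - h mod n) mod n" by (simp add: mod_simps)
    also have "\<dots> = (v + e - 2 * e) mod n" unfolding e[symmetric] by (simp add: mod_simps)
    finally show ?thesis by simp
  qed
  moreover have "(y + e) mod n \<in> {0..<n}" "(w + e) mod n \<in> {0..<n}" using n(2) by auto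
  ultimately show ?thesis using cyc_norm_shift[OF n(1), of "(y + e) mod n" "(w + e) mod n"] by metis
qed

text \<open>Eliminating \<open>b = a - x\<close> leaves the linear congruence
  \<open>2 * x * a = y + x * x\<close>, and \<open>2 * x\<close> is a unit because \<open>n\<close>
  is odd.\<close>

lemma parabola_difference:
  fixes n x y :: int
  assumes "odd n" "0 < n" "coprime x n" "0 \<le> y" "y < n" "0 \<le> x" "x < n"
  obtains a b where "a \<in> {0..<n}" "b \<in> {0..<n}" "(a - b) mod n = x"
    "(a * a mod n - b * b mod n) mod n = y"
proof -
  have "coprime (2 * x) n" using assms by simp
  then obtain i where i: "[2 * x * i = 1] (mod n)" using cong_solve_coprime_int by blast
  define a where "a = i * (y + x * x) mod n"
  define b where "b = (a - x) mod n"
  have "[2 * x * a = 2 * x * i * (y + x * x)] (mod n)"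
    unfolding a_def cong_def mod_mult_right_eq by (simp only: mult.assoc)
  also have "[2 * x * i * (y + x * x) = 1 * (y + x * x)] (mod n)" using i by (rule cong_scalar_right)
  finally have "[2 * x * a - x * x = y] (mod n)"
    by (simp add: cong_iff_dvd_diff algebra_simps)
  moreover have "(a * a mod n - b * b mod n) mod n = (2 * x * a - x * x) mod n"
  proof -
    have "b * b mod n = (a - x) * (a - x) mod n" by (simp add: b_def mod_mult_eq)
    then have "(a * a mod n - b * b mod n) mod n = (a * a - (a - x) * (a - x)) mod n"
      by (simp add: mod_diff_eq)
    then show ?thesis by (simp add: algebra_simps)
  qed
  ultimately have "(a * a mod n - b * b mod n) mod n = y" using assms by (simp add: cong_def)
  moreover have "(a - b) mod n = x" unfolding b_def using assms by (simp add: mod_diff_right_eq)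
  moreover have "a \<in> {0..<n}" "b \<in> {0..<n}" unfolding a_def b_def using assms(2) by simp_all
  ultimately show ?thesis using that by blast
qed

lemma connection_set_cover:
  assumes n: "n = 2 * h + 1" "0 < h" and e: "0 < e" "e < n" "(2 * e) mod n = h mod n"
    and g: "g \<in> carrier (swap_group n)"
  shows "g = \<one>\<^bsub>swap_group n\<^esub> \<or> g \<in> connection_set n e \<or>
    (\<exists>p\<in>connection_set n e. \<exists>q\<in>connection_set n e. g = p \<otimes>\<^bsub>swap_group n\<^esub> q)"
proof -
  obtain x y z w s where gs: "g = (x, y, z, w, s)" by (cases g)
  have r: "x \<in> {0..<n}" "y \<in> {0..<n}" "z \<in> {0..<n}" "w \<in> {0..<n}" using g gs by auto
  have n0: "0 < n" using n by simp
  let ?X = "connection_set n e"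
  show ?thesis
  proof (cases s)
    case True
    \<comment> \<open>\<open>(y', w')\<close> is the vertical offset of \<open>g\<close> from the
      parabola element with the same first and third coordinates.\<close>
    define y' where "y' = (y - x * x) mod n"
    define w' where "w' = (w - z * z) mod n"
    have b: "y' \<in> {0..<n}" "w' \<in> {0..<n}" using n0 by (auto simp: y'_def w'_def)
    have yw: "(y' + x * x mod n) mod n = y" "(w' + z * z mod n) mod n = w"
      using r by (auto simp: y'_def w'_def mod_simps)
    have D: "(x, x * x mod n, z, z * z mod n, True) \<in> ?X" using r by (intro parabola_partI) auto
    consider "(y', w') = (0, 0)" | "(y', w') \<noteq> (0, 0)" "cyc_norm n w' \<le> cyc_norm n y'"
      | "(y', w') \<noteq> (0, 0)" "cyc_norm n y' \<le> cyc_norm n w'" by linarith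
    then show ?thesis
    proof cases
      case 1
      then show ?thesis using D gs yw True by simp
    next
      case 2
      have "g = (0, y', 0, w', False) \<otimes>\<^bsub>swap_group n\<^esub> (x, x * x mod n, z, z * z mod n, True)"
        using gs True yw r by simp
      then show ?thesis using D axis_partI[OF b] 2 by blast
    next
      case 3
      have "g = (x, x * x mod n, z, z * z mod n, True) \<otimes>\<^bsub>swap_group n\<^esub>
          (0, (- w') mod n, 0, (- y') mod n, False)"
        using gs True yw r by (simp add: mod_simps add.commute)
      moreover have "(0, (- w') mod n, 0, (- y') mod n, False) \<in> ?X"
        using 3 b by (intro axis_partI_neg) auto
      ultimately show ?thesis using D by blast
    qed
  next
    case False
    show ?thesis
    proof (cases "coprime x n \<and> coprime z n")
      case True
      have o: "odd n" using n by simp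
      from True r obtain a b where ab: "a \<in> {0..<n}" "b \<in> {0..<n}" "(a - b) mod n = x"
        "(a * a mod n - b * b mod n) mod n = y" using parabola_difference[OF o n0, of x y] by auto
      from True r obtain a' b' where ab': "a' \<in> {0..<n}" "b' \<in> {0..<n}" "(a' - b') mod n = z"
        "(a' * a' mod n - b' * b' mod n) mod n = w" using parabola_difference[OF o n0, of z w] by auto
      have "g = (a, a * a mod n, a', a' * a' mod n, True) \<otimes>\<^bsub>swap_group n\<^esub>
          (b', b' * b' mod n, b, b * b mod n, True)"
        using gs False ab ab' by simp
      then show ?thesis using parabola_partI ab ab' by blast
    next
      case ncop: False
      \<comment> \<open>Modulo \<open>n\<close>, \<open>n - e\<close> is \<open>-e\<close>. The
        correction element supplies \<open>x\<close> and \<open>z\<close>, and the shift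
        \<open>c\<close> is chosen so that what remains lies in the axis part.\<close>
      have "\<exists>c. (c = e \<or> c = n - e) \<and> cyc_norm n ((w - c) mod n) \<le> cyc_norm n ((y - c) mod n)"
      proof -
        have "(v - (n - e)) mod n = (v + e) mod n" for v
          by (metis add_diff_eq diff_add_eq diff_diff_eq2 minus_mod_self2)
        then show ?thesis using axis_shift_cover[OF n(1) n0 e(3), of w y] by (metis)
      qed
      then obtain c where c: "c = e \<or> c = n - e"
        "cyc_norm n ((w - c) mod n) \<le> cyc_norm n ((y - c) mod n)" by blast
      have E: "(x, c, z, c, False) \<in> ?X" using correction_partI ncop c r by blast
      have yw: "((y - c) mod n + c) mod n = y" "((w - c) mod n + c) mod n = w"
        using r by (auto simp: mod_simps)
      show ?thesis
      \<comment> \<open>The axis part omits the identity; if the remainder vanishes,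
        \<open>g\<close> itself is a correction element.\<close>
      proof (cases "((y - c) mod n, (w - c) mod n) = (0, 0)")
        case True
        then have "c mod n = y" "c mod n = w" using yw by auto
        moreover have "c mod n = c" using c e by (intro mod_pos_pos_trivial) auto
        ultimately have "y = c" "w = c" by auto
        then show ?thesis using E gs \<open>\<not> s\<close> by simp
      next
        case nz: False
        have "g = (0, (y - c) mod n, 0, (w - c) mod n, False) \<otimes>\<^bsub>swap_group n\<^esub> (x, c, z, c, False)"
          using gs False yw r by simp
        moreover have "(0, (y - c) mod n, 0, (w - c) mod n, False) \<in> ?X"
          using nz c n0 by (intro axis_partI) auto
        ultimately show ?thesis using E by blast
      qed
    qed
  qed
qed

section \<open>Size of the connection set\<close>

text \<open>The relation \<open>?R\<close> and its mirror image \<open>?R'\<close> have equal size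
  and cover all pairs. They overlap only where \<open>w = y\<close> or \<open>w = n - y\<close>,
  hence in at most \<open>2 * n\<close> pairs.\<close>

lemma card_axis_part:
  assumes "0 < n"
  shows "2 * card (axis_part n) \<le> nat n ^ 2 + 2 * nat n"
proof -
  let ?U = "{0..<n} \<times> {0..<n}"
  let ?R = "{(y, w) \<in> ?U. cyc_norm n w \<le> cyc_norm n y}"
  let ?R' = "{(y, w) \<in> ?U. cyc_norm n y \<le> cyc_norm n w}"
  have fin: "finite ?R" "finite ?R'" by (auto intro: finite_subset[of _ ?U])
  have "card (axis_part n) \<le> card (?R - {(0, 0)})"
    unfolding axis_part_def using fin by (intro card_image_le) auto
  also have "\<dots> \<le> card ?R" using fin by (intro card_mono) auto
  finally have 1: "card (axis_part n) \<le> card ?R" .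
  have "?R' = prod.swap ` ?R" by force
  then have "card ?R' = card ?R" by (simp add: card_image inj_on_def)
  moreover have "?R \<union> ?R' = ?U" by auto
  moreover have "card ?U = nat n ^ 2" by (simp add: card_cartesian_product power2_eq_square)
  ultimately have 2: "2 * card ?R = nat n ^ 2 + card (?R \<inter> ?R')"
    using card_Un_Int[OF fin] by simp
  have "card (?R \<inter> ?R') \<le> card ((\<lambda>y. (y, y)) ` {0..<n} \<union> (\<lambda>y. (y, n - y)) ` {0..<n})"
  proof (intro card_mono subsetI)
    fix p assume p: "p \<in> ?R \<inter> ?R'"
    then obtain y w where yw: "p = (y, w)" "y \<in> {0..<n}" "cyc_norm n y = cyc_norm n w" by force
    then have "w = y \<or> w = n - y" by (auto simp: cyc_norm_def min_def split: if_splits)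
    then show "p \<in> (\<lambda>y. (y, y)) ` {0..<n} \<union> (\<lambda>y. (y, n - y)) ` {0..<n}" using yw by auto
  qed simp
  also have "\<dots> \<le> card ((\<lambda>y. (y, y)) ` {0..<n}) + card ((\<lambda>y. (y, n - y)) ` {0..<n})"
    by (rule card_Un_le)
  also have "\<dots> \<le> nat n + nat n"
    using card_image_le[of "{0..<n}" "\<lambda>y. (y, y)"] card_image_le[of "{0..<n}" "\<lambda>y. (y, n - y)"]
    by simp
  finally show ?thesis using 1 2 by linarith
qed

lemma card_correction_part:
  "card (correction_part n e) \<le> 4 * nat n * card {u \<in> {0..<n}. \<not> coprime u n}"
proof -
  let ?B = "{u \<in> {0..<n}. \<not> coprime u n}"
  let ?P = "{(u, z) \<in> {0..<n} \<times> {0..<n}. \<not> coprime u n \<or> \<not> coprime z n}"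
  have "?P = ?B \<times> {0..<n} \<union> {0..<n} \<times> ?B" by auto
  then have "card ?P \<le> card (?B \<times> {0..<n}) + card ({0..<n} \<times> ?B)" using card_Un_le by metis
  then have P: "card ?P \<le> 2 * nat n * card ?B" by (simp add: card_cartesian_product algebra_simps)
  have fin: "finite ?P" by (auto intro: finite_subset[of _ "{0..<n} \<times> {0..<n}"])
  have "card (correction_part n e) \<le> card (?P \<times> {e, n - e})"
    unfolding correction_part_def using fin by (intro card_image_le) auto
  also have "\<dots> \<le> card ?P * 2"
    unfolding card_cartesian_product by (intro mult_left_mono) (auto simp: card_insert_if)
  finally show ?thesis using P by linarith
qed

lemma card_connection_set:
  assumes "0 < n"
  shows "2 * card (connection_set n e) \<le>
    3 * nat n ^ 2 + 2 * nat n + 8 * nat n * card {u \<in> {0..<n}. \<not> coprime u n}"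
proof -
  have "card (parabola_part n) \<le> card ({0..<n} \<times> {0..<n})"
    unfolding parabola_part_def by (intro card_image_le) auto
  then have "card (parabola_part n) \<le> nat n ^ 2" by (simp add: card_cartesian_product power2_eq_square)
  moreover have "card (connection_set n e) \<le>
      card (parabola_part n) + card (axis_part n) + card (correction_part n e)"
    unfolding connection_set_def by (meson card_Un_le add_right_mono order.trans)
  ultimately show ?thesis using card_axis_part[OF assms] card_correction_part[of n e] by linarith
qed

lemma swap_group_card_le_C2:
  fixes n d :: nat
  assumes n: "odd n" "1 < n"
    and d: "3 * n ^ 2 + 2 * n + 8 * n * card {u \<in> {0..<int n}. \<not> coprime u (int n)} \<le> 2 * d"
      "d + 1 < 2 * n ^ 4"
  shows "2 * n ^ 4 \<le> C2 d"
proof -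
  obtain h where h: "int n = 2 * h + 1" using n(1) by (metis oddE even_of_nat)
  have h0: "0 < h" using h n by linarith
  \<comment> \<open>This is half of \<open>h\<close> modulo \<open>n\<close>: since \<open>n\<close>
    is odd, one of \<open>h\<close> and \<open>h + n\<close> is even.\<close>
  define e where "e = (if even h then h div 2 else (h + int n) div 2)"
  have "even (h + int n)" if "odd h" using that h by simp
  then have 2: "2 * e = (if even h then h else h + int n)"
    unfolding e_def by (simp only: if_distrib dvd_mult_div_cancel split: if_split) simp
  have e: "0 < e" "e < int n" using 2 h h0 by (auto split: if_splits)
  have e2: "(2 * e) mod int n = h mod int n" unfolding 2 by simp
  interpret group "swap_group (int n)" using n by (intro group_swap_group) auto
  let ?X = "connection_set (int n) e"
  \<comment> \<open>An involution because its two coordinate pairs agree; it lies off the parabola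
    because 1 is not the square of 0.\<close>
  let ?t = "(0, 1, 0, 1, True) :: int \<times> int \<times> int \<times> int \<times> bool"
  have "card (carrier (swap_group (int n))) \<le> C2 d"
  proof (rule card_le_C2_if_degree_ge)
    show "?X \<subseteq> carrier (swap_group (int n))"
    proof
      fix g assume "g \<in> ?X"
      then show "g \<in> carrier (swap_group (int n))"
        using e n by (cases rule: connection_set_cases) auto
    qed
    show "\<one>\<^bsub>swap_group (int n)\<^esub> \<notin> ?X"
    proof
      assume "\<one>\<^bsub>swap_group (int n)\<^esub> \<in> ?X"
      then show False using e by (cases rule: connection_set_cases) auto
    qed
    show "inv\<^bsub>swap_group (int n)\<^esub> x \<in> ?X" if "x \<in> ?X" for x
      using connection_set_inv[OF e(1,2) that] .
    show "g = \<one>\<^bsub>swap_group (int n)\<^esub> \<or> g \<in> ?X \<or>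
      (\<exists>x\<in>?X. \<exists>y\<in>?X. g = x \<otimes>\<^bsub>swap_group (int n)\<^esub> y)"
      if "g \<in> carrier (swap_group (int n))" for g
      using connection_set_cover[OF h h0 e e2 that] .
    show "?t \<in> carrier (swap_group (int n))" using n by auto
    then show "inv\<^bsub>swap_group (int n)\<^esub> ?t = ?t" using inv_swap_group[of "int n" 0 1 0 1 True] n by auto
    show "?t \<notin> ?X"
    proof
      assume "?t \<in> ?X"
      then show False by (cases rule: connection_set_cases) auto
    qed
    show "card ?X \<le> d" using card_connection_set[of "int n" e] d n by simp
    show "d + 1 < card (carrier (swap_group (int n)))" using d(2) by (simp only: card_carrier_swap_group nat_int)
  qed (simp_all)
  then show ?thesis by (simp only: card_carrier_swap_group nat_int)
qed

section \<open>The moduli\<close>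

text \<open>
  Consecutive primes \<open>r < r'\<close> in this list satisfy \<open>1551 r'\<^sup>2 \<le> 1700 r\<^sup>2\<close>, and the list spans a factor of
  almost 101. Multiplying by powers of 101 therefore gives moduli \<open>n = r 101\<^sup>a\<close> such that every large \<open>d\<close>
  lies between \<open>1.551 n\<^sup>2\<close> and \<open>1.7 n\<^sup>2\<close>.
\<close>
definition ladder :: "nat list" where
  "ladder = [479, 499, 521, 541, 563, 587, 613, 641, 661, 691, 719, 751, 773, 809, 839, 877, 911,
    953, 997, 1039, 1087, 1129, 1181, 1231, 1283, 1327, 1381, 1439, 1499, 1567, 1637, 1709, 1789,
    1871, 1951, 2039, 2131, 2221, 2311, 2417, 2521, 2633, 2753, 2879, 3011, 3137, 3271, 3413, 3571,
    3733, 3907, 4079, 4261, 4457, 4663, 4877, 5101, 5333, 5581, 5839, 6113, 6397, 6691, 7001, 7321,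
    7649, 7993, 8363, 8753, 9161, 9587, 10009, 10477, 10957, 11471, 12007, 12569, 13151, 13763,
    14407, 15083, 15787, 16519, 17293, 18097, 18919, 19801, 20719, 21683, 22699, 23761, 24859,
    26021, 27241, 28517, 29851, 31249, 32713, 34231, 35837, 37517, 39251, 41081, 43003, 45013, 47123]"

section \<open>Primality of the ladder by executable trial division\<close>

function no_divisor_from :: "nat \<Rightarrow> nat \<Rightarrow> bool" where
  "no_divisor_from k r =
    (if k = 0 \<or> r < k * k then True
     else if r mod k = 0 then False
     else no_divisor_from (k + 2) r)"
  by auto
termination
proof (relation "measure (\<lambda>(k, r). Suc r - k)")
  fix k r :: nat
  assume "\<not> (k = 0 \<or> r < k * k)"
  then have "0 < k" "k * k \<le> r" by auto
  then have "k \<le> r" using order.trans[of k "k * k" r] by simp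
  with \<open>0 < k\<close> show "((k + 2, r), (k, r)) \<in> measure (\<lambda>(k, r). Suc r - k)" by auto
qed auto

declare no_divisor_from.simps [simp del]

lemma no_divisor_from_dvd:
  assumes "no_divisor_from k r" "0 < k" "k \<le> j" "odd k" "odd j" "j * j \<le> r"
  shows "\<not> j dvd r"
  using assms
proof (induction k r rule: no_divisor_from.induct)
  case (1 k r)
  have "k * k \<le> j * j" using "1.prems" by (intro mult_mono) auto
  then have *: "\<not> (k = 0 \<or> r < k * k)" using "1.prems" by auto
  then have k: "r mod k \<noteq> 0" "no_divisor_from (k + 2) r"
    using "1.prems"(1) by (auto simp: no_divisor_from.simps[of k r] split: if_splits)
  show ?case
  proof (cases "j = k")
    case True
    then show ?thesis using k by auto
  next
    case False
    then have "k + 2 \<le> j" using "1.prems" by presburger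
    then show ?thesis using "1.IH"[OF * k(1)] k(2) "1.prems" by auto
  qed
qed

text \<open>In a proper factorisation \<open>r = a * b\<close> both factors are odd and at least 3.
  The test forces both squares above \<open>r\<close>, which is impossible for their
  product.\<close>

lemma prime_if_no_divisor_from:
  assumes "1 < r" "odd r" "no_divisor_from 3 r"
  shows "prime r"
proof (rule ccontr)
  assume "\<not> prime r"
  then obtain a where a: "a dvd r" "a \<noteq> 1" "a \<noteq> r" using assms(1) prime_nat_iff by auto
  then obtain b where b: "r = a * b" by auto
  then have odd: "odd a" "odd b" "b \<noteq> 1" using assms(2) a(3) by auto
  then have 1: "3 \<le> a" "3 \<le> b" using a(2) by presburger+
  have "\<not> j dvd r" if "3 \<le> j" "odd j" "j * j \<le> r" for j
    using no_divisor_from_dvd[OF assms(3), of j] that by auto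
  then have "r < a * a" "r < b * b" using 1 odd b by (metis dvd_triv_left dvd_triv_right not_le)+
  then show False unfolding b by (cases a b rule: linorder_cases) auto
qed

lemma prime_ladder:
  assumes "r \<in> set ladder"
  shows "prime r"
proof -
  have "list_all (\<lambda>r. 1 < r \<and> r mod 2 = 1 \<and> no_divisor_from 3 r) ladder"
    unfolding ladder_def by code_simp
  then show ?thesis
    using assms prime_if_no_divisor_from[of r] by (simp add: list_all_iff odd_iff_mod_2_eq_one)
qed

lemma ladder_steps: "successively (\<lambda>x y. 1551 * y^2 \<le> 1700 * x^2) ladder"
  unfolding ladder_def by simp

lemma ladder_min: "\<forall>r\<in>set ladder. 479 \<le> r"
  unfolding ladder_def by simp

text \<open>The step condition makes consecutive intervals from \<open>1551 * r^2 * c\<close> to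
  \<open>1700 * r^2 * c\<close> meet, so together they leave no gap.\<close>

lemma ladder_covers:
  assumes "successively (\<lambda>x y. 1551 * y^2 \<le> 1700 * x^2) L" "L \<noteq> []"
    and "1551 * (hd L)^2 * c \<le> t" "t \<le> 1700 * (last L)^2 * (c::nat)"
  shows "\<exists>r\<in>set L. 1551 * r^2 * c \<le> t \<and> t \<le> 1700 * r^2 * c"
  using assms
proof (induction L)
  case (Cons x L)
  show ?case
  proof (cases "t \<le> 1700 * x^2 * c")
    case False
    then have L: "L \<noteq> []" using Cons.prems by (cases L) auto
    then obtain y L' where L': "L = y # L'" by (cases L) auto
    then have "1551 * y^2 * c \<le> 1700 * x^2 * c" using Cons.prems by (intro mult_right_mono) auto
    then have "1551 * (hd L)^2 * c \<le> t" using False L' by (simp only: list.sel)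
    then have "\<exists>r\<in>set L. 1551 * r^2 * c \<le> t \<and> t \<le> 1700 * r^2 * c"
      using Cons.prems L L' by (intro Cons.IH) auto
    then show ?thesis by auto
  qed (use Cons.prems in auto)
qed simp

lemma exists_power_times_ladder:
  assumes "360756 \<le> (d::nat)"
  shows "\<exists>r\<in>set ladder. \<exists>a. 1551 * (r * 101^a)^2 \<le> 1000 * d \<and> 1000 * d \<le> 1700 * (r * 101^a)^2"
proof -
  let ?c = "\<lambda>a. (101::nat)^(2*a)"
  let ?P = "\<lambda>a. 1000 * d < 1551 * 479^2 * ?c a"
  have "\<exists>a. ?P a"
  proof (intro exI)
    have "1000 * d < 2 ^ (1000 * d)" by simp
    also have "\<dots> \<le> 101 ^ (2 * (1000 * d))" by (intro order.trans[OF power_mono[of 2 101] power_increasing]) auto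
    finally show "?P (1000 * d)" by simp
  qed
  then have P: "?P (LEAST a. ?P a)" by (rule LeastI_ex)
  have "(LEAST a. ?P a) \<noteq> 0"
  proof
    assume "(LEAST a. ?P a) = 0"
    with P show False using assms by simp
  qed
  then obtain a where a: "(LEAST a. ?P a) = Suc a" using not0_implies_Suc by blast
  then have 1: "\<not> ?P a" using not_less_Least[of a ?P] by simp
  have 2: "?P (Suc a)" using P a by simp
  \<comment> \<open>The top interval reaches the next scale:
    \<open>1551 * (479 * 101)^2 \<le> 1700 * 47123^2\<close>.\<close>
  have "\<exists>r\<in>set ladder. 1551 * r^2 * ?c a \<le> 1000 * d \<and> 1000 * d \<le> 1700 * r^2 * ?c a"
    using 1 2 by (intro ladder_covers[OF ladder_steps]) (auto simp: ladder_def)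
  moreover have "(r * 101^a)^2 = r^2 * ?c a" for r by (simp add: power_mult_distrib power_even_eq)
  ultimately show ?thesis by (metis mult.assoc)
qed

section \<open>Counting residues that are not units\<close>

lemma card_multiples_le:
  "card {u \<in> {0..<int (p * m)}. int p dvd u} \<le> m"
proof (cases "p = 0")
  case False
  have "{u \<in> {0..<int (p * m)}. int p dvd u} \<subseteq> (\<lambda>i. int (p * i)) ` {0..<m}"
  proof
    fix u assume u: "u \<in> {u \<in> {0..<int (p * m)}. int p dvd u}"
    then obtain i where i: "u = int p * i" by auto
    then have "0 \<le> i" "i < int m" using u False by (auto simp: zero_le_mult_iff)
    then show "u \<in> (\<lambda>i. int (p * i)) ` {0..<m}" using i by (intro image_eqI[of _ _ "nat i"]) auto
  qed
  then have "card {u \<in> {0..<int (p * m)}. int p dvd u} \<le> card ((\<lambda>i. int (p * i)) ` {0..<m})"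
    by (intro card_mono) auto
  also have "\<dots> \<le> m" using card_image_le[of "{0..<m}" "\<lambda>i. int (p * i)"] by simp
  finally show ?thesis .
qed simp

text \<open>A non-unit is a multiple of \<open>r\<close> or, when \<open>a > 0\<close>, of
  \<open>p\<close>; the two summands are the modulus divided by \<open>r\<close> and by
  \<open>p\<close>.\<close>

lemma card_not_coprime_prime_mult_power:
  fixes p r a :: nat
  assumes "prime p" "prime r"
  shows "card {u \<in> {0..<int (r * p ^ a)}. \<not> coprime u (int (r * p ^ a))} \<le>
    p ^ a + (if a = 0 then 0 else r * p ^ (a - 1))"
proof -
  let ?n = "r * p ^ a"
  let ?M = "\<lambda>q. {u \<in> {0..<int ?n}. int q dvd u}"
  have fin: "finite (?M q)" for q by (rule finite_subset[of _ "{0..<int ?n}"]) auto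
  have dvd: "int q dvd u" if "prime q" "\<not> coprime u (int q)" for q u
    using that prime_imp_coprime[of "int q" u] by (auto simp: coprime_commute)
  have "{u \<in> {0..<int ?n}. \<not> coprime u (int ?n)} \<subseteq> ?M r \<union> (if a = 0 then {} else ?M p)"
    using assms by (auto dest: dvd simp: coprime_power_right_iff)
  then have "card {u \<in> {0..<int ?n}. \<not> coprime u (int ?n)} \<le> card (?M r \<union> (if a = 0 then {} else ?M p))"
    using fin by (intro card_mono) (simp_all split: if_split)
  also have "\<dots> \<le> card (?M r) + card (if a = 0 then {} else ?M p)" by (rule card_Un_le)
  also have "\<dots> \<le> p ^ a + (if a = 0 then 0 else r * p ^ (a - 1))"
  proof (rule add_mono)
    show "card (?M r) \<le> p ^ a" by (rule card_multiples_le)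
    have n: "?n = p * (r * p ^ (a - 1))" if "a \<noteq> 0" using that by (cases a) auto
    show "card (if a = 0 then {} else ?M p) \<le> (if a = 0 then 0 else r * p ^ (a - 1))"
    proof (cases "a = 0")
      case False
      then show ?thesis
        using card_multiples_le[of p "r * p ^ (a - 1)"] by (simp only: n[OF False, symmetric] if_False)
    qed simp
  qed
  finally show ?thesis .
qed

lemma prime_101: "prime (101 :: nat)"
  by simp

theorem mainTheorem6:
  fixes d :: nat
  assumes "d \<ge> 360756"
  shows "real (C2 d) > 0.684 * (real d)^2"
proof -
  obtain r a where r: "r \<in> set ladder"
    and d: "1551 * (r * 101^a)^2 \<le> 1000 * d" "1000 * d \<le> 1700 * (r * 101^a)^2"
    using exists_power_times_ladder[OF assms] by blast
  have pr: "prime r" "479 \<le> r" using r prime_ladder ladder_min by auto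
  define n where "n = r * 101^a"
  define b where "b = card {u \<in> {0..<int n}. \<not> coprime u (int n)}"
  have b: "b \<le> 101 ^ a + (if a = 0 then 0 else r * 101 ^ (a - 1))"
    unfolding b_def n_def by (rule card_not_coprime_prime_mult_power[OF prime_101 pr(1)])
  have n479: "479 \<le> n" using pr(2) mult_le_mono[of 479 r 1 "101^a"] by (simp add: n_def)
  have "odd r" using pr prime_odd_nat[of r] by simp
  then have n: "odd n" "1 < n" using n479 by (auto simp: n_def)
  \<comment> \<open>Since \<open>2 * 1.551 = 3.102\<close>, a slack of \<open>0.102 * n^2\<close>
    over \<open>3 * n^2\<close> must absorb \<open>2 * n + 8 * n * b\<close>; this is that
    inequality times 1000, divided by \<open>n\<close>.\<close>
  have "2000 + 8000 * b \<le> 102 * n"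
  proof (cases a)
    case 0
    then show ?thesis using b n479 by simp
  next
    \<comment> \<open>Here \<open>b / n\<close> is at most \<open>1 / r + 1 / 101\<close>, so
      \<open>8000 * b\<close> is below \<open>96 * n\<close>; the remaining \<open>6 * n\<close>
      exceeds 2000.\<close>
    case (Suc k)
    have "1 * 1 \<le> (101::nat) ^ k" by simp
    moreover have "479 * 101 ^ k \<le> r * 101 ^ k" using pr(2) by simp
    moreover have "b \<le> 101 * 101 ^ k + r * 101 ^ k" "n = 101 * (r * 101 ^ k)"
      using b Suc by (auto simp: n_def)
    ultimately show ?thesis by linarith
  qed
  then have "(2000 + 8000 * b) * n \<le> (102 * n) * n" by (rule mult_right_mono) simp
  then have deg: "3 * n ^ 2 + 2 * n + 8 * n * b \<le> 2 * d"
    using d(1) unfolding n_def[symmetric] by (simp add: power2_eq_square algebra_simps)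
  have n4: "n ^ 4 = n ^ 2 * n ^ 2" by (simp flip: power_add)
  have "479 * 479 \<le> n ^ 2" unfolding power2_eq_square using n479 by (intro mult_mono) auto
  then have "2 * n ^ 2 + 2 \<le> n ^ 2 * n ^ 2" using mult_right_mono[of 3 "n ^ 2" "n ^ 2"] by linarith
  then have "d + 1 < 2 * n ^ 4" using d(2) unfolding n_def[symmetric] n4 by linarith
  then have "2 * n ^ 4 \<le> C2 d" using swap_group_card_le_C2[OF n] deg unfolding b_def by blast
  then have "2 * real n ^ 4 \<le> real (C2 d)" by (metis of_nat_le_iff of_nat_mult of_nat_numeral of_nat_power)
  moreover have "0.684 * (real d)^2 < 2 * real n ^ 4"
  \<comment> \<open>From \<open>d \<le> 1.7 * n^2\<close> the ratio of \<open>2 * n^4\<close> to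
    \<open>d^2\<close> is at least \<open>2 / 2.89\<close>, which exceeds 0.692.\<close>
  proof -
    have "real (1000 * d) \<le> real (1700 * n ^ 2)" using d(2) unfolding n_def[symmetric] by (rule of_nat_mono)
    then have "real d \<le> 1.7 * real n ^ 2" by simp
    then have "(real d)^2 \<le> (1.7 * real n ^ 2)^2" by (intro power_mono) auto
    also have "\<dots> = 2.89 * real n ^ 4" by (simp add: power_mult_distrib power_divide flip: power_mult)
    finally have "100 * (real d)^2 \<le> 289 * real n ^ 4" by simp
    moreover have "0 < real n ^ 4" using n by simp
    ultimately have "171 * (real d)^2 < 500 * real n ^ 4" by linarith
    then show ?thesis by simp
  qed
  ultimately show ?thesis by linarith
qed

end
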